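(* Let $k$ and $n$ be positive integers, and consider $k$-uniform hypergraphs $\mathcal{H}$ with $n$ vertices. Then the following hold. (i) For every such $\mathcal{H}$, $\mathcal{E}(\mathcal{S}(\mathcal{H}))\ge\sqrt{n(n-1)}$. (ii) If for some such $\mathcal{H}$ equality holds in the inequality $\mathcal{E}(\mathcal{S}(\mathcal{H}))\ge\sqrt{n(n-1)}$, then $\mathcal{H}$ is linear. (iii) For every linear $k$-uniform hypergraph $\mathcal{H}$ on $n$ vertices, $$\sqrt{n(n-1)}\le\mathcal{E}(\mathcal{S}(\mathcal{H}))\le n\sqrt{n-1}.$$
   Context: A hypergraph $\mathcal{H}=(V,E)$ consists of a finite vertex set $V$ with $|V|=n$ (identified with $\{1,\dots,n\}$) and a set $E\subseteq 2^{V}$ of hyperedges. All hypergraphs are finite and simple: there is no hyperedge of size $1$, and for distinct hyperedges $e,e'$ neither $e\subset e'$ nor $e'\subset e$. $\mathcal{H}$ is $k$-uniform if every hyperedge has exactly $k$ elements. For distinct vertices $i,j$, the co-degree is $c_{ij}=|\{e\in E: i,j\in e\}|$. The Seidel matrix $\mathcal{S}(\mathcal{H})$ is the real symmetric $n\times n$ matrix with $\mathcal{S}(\mathcal{H})_{ii}=0$ and $\mathcal{S}(\mathcal{H})_{ij}=1-2c_{ij}$ for $i\ne j$. If $\rho_1,\dots,\rho_n$ are its eigenvalues (with multiplicity), the Seidel energy is $\mathcal{E}(\mathcal{S}(\mathcal{H}))=\sum_{i=1}^n|\rho_i|$. A hypergraph is linear if it is simple and $|e\cap e'|\le 1$ for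 all distinct hyperedges $e,e'$. *)

theory Defs
  imports "HOL-Computational_Algebra.Computational_Algebra" "Jordan_Normal_Form.Char_Poly"
begin

(* A hypergraph on n vertices is given by n and its set E of hyperedges;
   the vertex set is {1..n}. *)

definition simple_hypergraph :: "nat \<Rightarrow> nat set set \<Rightarrow> bool" where
  "simple_hypergraph n E \<longleftrightarrow>
     E \<subseteq> Pow {1..n} \<and>
     (\<forall>e\<in>E. card e \<noteq> 1) \<and>
     (\<forall>e\<in>E. \<forall>e'\<in>E. e \<noteq> e' \<longrightarrow> \<not> e \<subset> e' \<and> \<not> e' \<subset> e)"

definition uniform_edges :: "nat \<Rightarrow> nat set set \<Rightarrow> bool" where
  "uniform_edges k E \<longleftrightarrow> (\<forall>e\<in>E. card e = k)"

definition linear_hypergraph :: "nat \<Rightarrow> nat set set \<Rightarrow> bool" where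
  "linear_hypergraph n E \<longleftrightarrow>
     simple_hypergraph n E \<and>
     (\<forall>e\<in>E. \<forall>e'\<in>E. e \<noteq> e' \<longrightarrow> card (e \<inter> e') \<le> 1)"

definition codegree :: "nat set set \<Rightarrow> nat \<Rightarrow> nat \<Rightarrow> nat" where
  "codegree E i j = card {e \<in> E. i \<in> e \<and> j \<in> e}"

(* Matrix indices start at 0, so row i belongs to vertex i + 1. *)
definition seidel_matrix :: "nat \<Rightarrow> nat set set \<Rightarrow> real mat" where
  "seidel_matrix n E =
     mat n n (\<lambda>(i, j). if i = j then 0 else 1 - 2 * real (codegree E (Suc i) (Suc j)))"

(* proots lists the real eigenvalues with algebraic multiplicity. For a Seidel matrix these
   are all n eigenvalues, by size_seidel_spectrum below. *)
definition seidel_spectrum :: "nat \<Rightarrow> nat set set \<Rightarrow> real multiset" where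
  "seidel_spectrum n E = proots (char_poly (seidel_matrix n E))"

definition seidel_energy :: "nat \<Rightarrow> nat set set \<Rightarrow> real" where
  "seidel_energy n E = (\<Sum>\<rho>\<in>#seidel_spectrum n E. \<bar>\<rho>\<bar>)"

lemma seidel_matrix_carrier: "seidel_matrix n E \<in> carrier_mat n n"
  by (simp add: seidel_matrix_def)

lemma codegree_commute: "codegree E i j = codegree E j i"
  unfolding codegree_def by (rule arg_cong[where f = card]) auto

lemma transpose_seidel_matrix: "transpose_mat (seidel_matrix n E) = seidel_matrix n E"
  by (rule eq_matI) (auto simp: seidel_matrix_def codegree_commute)

lemma symmetric_eigenvalue_real:
  fixes A :: "real mat"
  assumes A: "A \<in> carrier_mat n n" and sym: "transpose_mat A = A"
    and ev: "eigenvalue (map_mat complex_of_real A) z"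
  shows "z \<in> \<real>"
proof -
  let ?B = "map_mat complex_of_real A"
  have B: "?B \<in> carrier_mat n n" using A by simp
  have symB: "transpose_mat ?B = ?B" using sym A by (metis map_mat_transpose)
  obtain v where v: "v \<in> carrier_vec n" "v \<noteq> 0\<^sub>v n" "?B *\<^sub>v v = z \<cdot>\<^sub>v v"
    using ev A unfolding eigenvalue_def eigenvector_def by auto
  have cv: "conjugate v \<in> carrier_vec n" using v(1) by simp
  have "conjugate (?B *\<^sub>v v) = ?B *\<^sub>v conjugate v"
  proof (rule eq_vecI)
    fix i assume "i < dim_vec (?B *\<^sub>v conjugate v)"
    then have i: "i < n" using A by simp
    have "row ?B i \<in> carrier_vec n" using row_carrier_vec[OF i B] .
    moreover have "conjugate (row ?B i) = row ?B i" using A i by (intro eq_vecI) auto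
    ultimately show "conjugate (?B *\<^sub>v v) $ i = (?B *\<^sub>v conjugate v) $ i"
      using i A v(1) conjugate_sprod_vec[of "row ?B i" n v] by simp
  qed (use A in simp)
  then have Bc: "?B *\<^sub>v conjugate v = conjugate z \<cdot>\<^sub>v conjugate v"
    using v(3) by (simp add: conjugate_smult_vec)
  have "z * (v \<bullet>c v) = (?B *\<^sub>v v) \<bullet>c v" using v(1,3) cv by simp
  also have "\<dots> = v \<bullet> (?B *\<^sub>v conjugate v)"
    using transpose_vec_mult_scalar[OF B cv v(1)] symB by simp
  also have "\<dots> = conjugate z * (v \<bullet>c v)" using Bc v(1) cv by simp
  finally have "z = cnj z" using v(1,2) by simp
  then show ?thesis by (simp add: complex_is_Real_iff complex_eq_iff)
qed

lemma size_proots_symmetric: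
  fixes A :: "real mat"
  assumes A: "A \<in> carrier_mat n n" and sym: "transpose_mat A = A"
  shows "size (proots (char_poly A)) = n"
proof -
  let ?B = "map_mat complex_of_real A"
  have B: "?B \<in> carrier_mat n n" using A by simp
  obtain as where as: "char_poly ?B = (\<Prod>a\<leftarrow>as. [:- a, 1:])" "length as = n"
    using char_poly_factorized[OF B] by blast
  have real: "a \<in> \<real>" if "a \<in> set as" for a
  proof -
    have "poly (char_poly ?B) a = 0"
      using that unfolding as(1) by (auto simp: poly_prod_list prod_list_zero_iff)
    then show ?thesis
      using symmetric_eigenvalue_real[OF A sym] eigenvalue_root_char_poly[OF B] by blast
  qed
  let ?q = "\<Prod>a\<leftarrow>map Re as. [:- a, 1:]"
  have "map_poly complex_of_real ?q = (\<Prod>a\<leftarrow>as. [:- a, 1:])"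
    using real
  proof (induction as)
    case (Cons a as)
    interpret h: map_poly_comm_ring_hom complex_of_real ..
    have "map_poly complex_of_real [:- Re a, 1:] = [:- a, 1:]" using Cons.prems by simp
    then show ?case using Cons
      by (simp only: list.map prod_list.Cons h.hom_mult) simp
  qed simp
  then have "map_poly complex_of_real (char_poly A) = map_poly complex_of_real ?q"
    using as(1) of_real_hom.char_poly_hom[OF A, where 'a = complex] by simp
  then have "char_poly A = ?q" by (simp add: poly_eq_iff coeff_map_poly)
  moreover have "size (proots (\<Prod>a\<leftarrow>xs. [:- a, 1:])) = length xs" for xs :: "real list"
  proof (induction xs)
    case (Cons x xs)
    have "(\<Prod>a\<leftarrow>xs. [:- a, 1:]) \<noteq> 0" by (auto simp: prod_list_zero_iff)
    then show ?case using Cons by (simp add: proots_mult del: mult_pCons_left)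
  qed simp
  ultimately show ?thesis using as(2) by (metis length_map)
qed

lemma size_seidel_spectrum: "size (seidel_spectrum n E) = n"
  unfolding seidel_spectrum_def
  by (rule size_proots_symmetric[OF seidel_matrix_carrier transpose_seidel_matrix])

end

theory Submission
  imports Defs "Jordan_Normal_Form.Schur_Decomposition" "HOL-Analysis.Convex"
begin

text \<open>For a real symmetric matrix the squares of the eigenvalues sum to the squares of the
  entries. The off-diagonal entries of a Seidel matrix are odd integers, so this sum is at least
  \<open>n (n - 1)\<close>, with equality exactly when all co-degrees are \<open>0\<close> or \<open>1\<close>, that is, when no two
  edges share two vertices. Comparing the 1-norm of the spectrum with its 2-norm does the rest.\<close>

definition mat_trace :: "'a :: comm_monoid_add mat \<Rightarrow> 'a" where
  "mat_trace A = (\<Sum>i<dim_row A. A $$ (i, i))"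

lemma mat_trace_times:
  fixes A B :: "'a :: semiring_0 mat"
  assumes "A \<in> carrier_mat n m" "B \<in> carrier_mat m n"
  shows "mat_trace (A * B) = (\<Sum>i<n. \<Sum>j<m. A $$ (i, j) * B $$ (j, i))"
  using assms by (auto simp: mat_trace_def scalar_prod_def atLeast0LessThan intro!: sum.cong)

lemma mat_trace_mult_commute:
  fixes A B :: "'a :: comm_semiring_0 mat"
  assumes A: "A \<in> carrier_mat n m" and B: "B \<in> carrier_mat m n"
  shows "mat_trace (A * B) = mat_trace (B * A)"
  unfolding mat_trace_times[OF A B] mat_trace_times[OF B A]
  by (subst sum.swap) (simp add: mult.commute)

text \<open>Cyclicity of the trace moves \<open>P\<close> to the far right of
  \<open>P * B * Q\<close>, where \<open>Q * P\<close> is the identity.\<close>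

lemma mat_trace_similar:
  fixes A B :: "'a :: comm_semiring_1 mat"
  assumes "similar_mat_wit A B P Q"
  shows "mat_trace A = mat_trace B"
proof -
  define n where "n = dim_row A"
  note D = similar_mat_witD[OF n_def assms]
  have "mat_trace A = mat_trace (P * (B * Q))"
    using D by (simp add: assoc_mult_mat[of _ n n _ n _ n])
  also have "\<dots> = mat_trace (B * Q * P)"
    using D by (intro mat_trace_mult_commute[of _ n n]) auto
  also have "B * Q * P = B"
    using D by (simp add: assoc_mult_mat[of _ n n _ n _ n])
  finally show ?thesis .
qed

lemma upper_triangular_square_diag:
  fixes B :: "'a :: semiring_1 mat"
  assumes B: "B \<in> carrier_mat n n" and ut: "upper_triangular B" and i: "i < n"
  shows "(B * B) $$ (i, i) = (B $$ (i, i))\<^sup>2"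
proof -
  have "(B * B) $$ (i, i) = (\<Sum>j<n. B $$ (i, j) * B $$ (j, i))"
    using B i by (auto simp: scalar_prod_def atLeast0LessThan intro!: sum.cong)
  also have "\<dots> = (\<Sum>j<n. if j = i then B $$ (i, i) * B $$ (i, i) else 0)"
  \<comment> \<open>For \<open>j \<noteq> i\<close> one of the positions \<open>(i, j)\<close> and
    \<open>(j, i)\<close> lies below the diagonal, so the product vanishes.\<close>
  proof (rule sum.cong)
    fix j assume "j \<in> {..<n}"
    then show "B $$ (i, j) * B $$ (j, i) = (if j = i then B $$ (i, i) * B $$ (i, i) else 0)"
      using B i upper_triangularD[OF ut, of j i] upper_triangularD[OF ut, of i j]
      by (cases i j rule: linorder_cases) auto
  qed simp
  also have "\<dots> = (B $$ (i, i))\<^sup>2"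
    using i by (simp add: power2_eq_square)
  finally show ?thesis .
qed

text \<open>Bridges \<open>proots\<close>, a multiset of roots, and the factorization over a list
  that Schur decomposition asks for. The length condition says that \<open>p\<close> splits; the
  induction divides off one root at a time.\<close>

lemma split_poly_eq_prod_list:
  fixes p :: "'a :: idom poly"
  assumes "mset es = proots p" "length es = degree p"
  shows "p = Polynomial.smult (lead_coeff p) (\<Prod>a\<leftarrow>es. [:- a, 1:])"
  using assms
proof (induction es arbitrary: p)
  case Nil
  then show ?case by (auto elim!: degree_eq_zeroE)
next
  case (Cons a es)
  then have p: "p \<noteq> 0" by auto
  have "a \<in># proots p" using Cons.prems(1)[symmetric] by simp
  then have "poly p a = 0" using p by simp
  then obtain q where q: "p = [:- a, 1:] * q" by (metis dvdE poly_eq_0_iff_dvd)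
  then have q0: "q \<noteq> 0" using p by auto
  have "mset es = proots q"
    using Cons.prems(1) q0 unfolding q by (simp add: proots_mult del: mult_pCons_left)
  moreover have "length es = degree q"
    using Cons.prems(2) q0 unfolding q by (simp add: degree_mult_eq del: mult_pCons_left)
  ultimately have IH: "q = Polynomial.smult (lead_coeff q) (\<Prod>a\<leftarrow>es. [:- a, 1:])"
    by (rule Cons.IH)
  have lead: "lead_coeff p = lead_coeff q"
    unfolding q by (simp only: lead_coeff_mult) simp
  have "p = [:- a, 1:] * Polynomial.smult (lead_coeff p) (\<Prod>a\<leftarrow>es. [:- a, 1:])"
    using q IH unfolding lead by simp
  then show ?case
    by (simp only: mult_smult_right list.map prod_list.Cons)
qed

text \<open>Both sides are the trace of \<open>A * A\<close>: the left one after triangularizing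
  \<open>A\<close> with its eigenvalues on the diagonal, the right one by symmetry of
  \<open>A\<close>.\<close>

lemma sum_proots_square_symmetric:
  fixes A :: "real mat"
  assumes A: "A \<in> carrier_mat n n" and sym: "transpose_mat A = A"
  shows "(\<Sum>\<rho>\<in>#proots (char_poly A). \<rho>\<^sup>2) = (\<Sum>i<n. \<Sum>j<n. (A $$ (i, j))\<^sup>2)"
proof -
  obtain es where es: "mset es = proots (char_poly A)"
    by (metis ex_mset)
  have len: "length es = n"
    using size_proots_symmetric[OF A sym] by (metis es size_mset)
  \<comment> \<open>The characteristic polynomial is monic of degree \<open>n\<close> and has
    \<open>n\<close> real roots, so the scalar factor is 1.\<close>
  have "char_poly A = (\<Prod>a\<leftarrow>es. [:- a, 1:])"
    using split_poly_eq_prod_list[OF es] degree_monic_char_poly[OF A] len by simp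
  moreover obtain B P Q where BPQ: "schur_decomposition A es = (B, P, Q)"
    by (metis prod_cases3)
  ultimately have sim: "similar_mat_wit A B P Q" and ut: "upper_triangular B"
    and diag: "diag_mat B = es"
    using schur_decomposition[OF A] by auto
  have B: "B \<in> carrier_mat n n"
    using similar_mat_witD2(5)[OF A sim] .
  have "(\<Sum>\<rho>\<in>#proots (char_poly A). \<rho>\<^sup>2) = (\<Sum>\<rho>\<leftarrow>es. \<rho>\<^sup>2)"
    by (simp flip: es sum_mset_sum_list)
  also have "\<dots> = (\<Sum>i<n. (B $$ (i, i))\<^sup>2)"
    using B unfolding diag[symmetric] diag_mat_def
    by (simp add: comp_def interv_sum_list_conv_sum_set_nat atLeast0LessThan)
  also have "\<dots> = mat_trace (B * B)"
    using B upper_triangular_square_diag[OF B ut] by (simp add: mat_trace_def)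
  \<comment> \<open>The witnesses \<open>P\<close> and \<open>Q\<close> of the similarity also serve
    for the second powers.\<close>
  also have "\<dots> = mat_trace (A * A)"
    using mat_trace_similar[OF similar_mat_wit_pow[OF sim, of 2]] A B
    by (simp add: numeral_2_eq_2)
  also have "\<dots> = (\<Sum>i<n. \<Sum>j<n. A $$ (i, j) * A $$ (j, i))"
    by (rule mat_trace_times[OF A A])
  also have "\<dots> = (\<Sum>i<n. \<Sum>j<n. (A $$ (i, j))\<^sup>2)"
  proof (intro sum.cong refl)
    fix i j assume "i \<in> {..<n}" "j \<in> {..<n}"
    then have "A $$ (j, i) = A $$ (i, j)"
      using A sym by (metis carrier_matD index_transpose_mat(1) lessThan_iff)
    then show "A $$ (i, j) * A $$ (j, i) = (A $$ (i, j))\<^sup>2"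
      by (simp add: power2_eq_square)
  qed
  finally show ?thesis .
qed

lemma sum_mset_abs_nonneg: "0 \<le> (\<Sum>x\<in>#M. \<bar>x :: real\<bar>)"
  by (induction M) auto

text \<open>Expanding the right-hand square yields the squares on the left plus nonnegative cross
  terms.\<close>

lemma sum_mset_square_le_square_sum_abs:
  fixes M :: "real multiset"
  shows "(\<Sum>x\<in>#M. x\<^sup>2) \<le> (\<Sum>x\<in>#M. \<bar>x\<bar>)\<^sup>2"
proof (induction M)
  case (add x M)
  define S where "S = (\<Sum>x\<in>#M. \<bar>x\<bar>)"
  have "0 \<le> \<bar>x\<bar> * S"
    unfolding S_def by (intro mult_nonneg_nonneg sum_mset_abs_nonneg) simp
  then show ?case
    using add by (simp add: power2_sum flip: S_def)
qed simp

text \<open>This is Cauchy-Schwarz against the all-ones vector. Summing over list positions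
  preserves the multiplicities.\<close>

lemma square_sum_abs_le_size_mult_sum_mset_square:
  fixes M :: "real multiset"
  shows "(\<Sum>x\<in>#M. \<bar>x\<bar>)\<^sup>2 \<le> real (size M) * (\<Sum>x\<in>#M. x\<^sup>2)"
proof -
  obtain xs where M: "M = mset xs" by (metis ex_mset)
  have sum: "(\<Sum>x\<in>#M. f x) = (\<Sum>i<length xs. f (xs ! i))" for f :: "real \<Rightarrow> real"
    unfolding M by (simp add: sum_mset_sum_list sum_list_sum_nth atLeast0LessThan
        flip: mset_map del: mset_map)
  show ?thesis
    unfolding sum using sum_squared_le_sum_of_squares[of "\<lambda>i. \<bar>xs ! i\<bar>" "{..<length xs}"]
    by (simp add: M mult.commute)
qed

lemma sum_seidel_spectrum_square:
  "(\<Sum>\<rho>\<in>#seidel_spectrum n E. \<rho>\<^sup>2) =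
     (\<Sum>(i, j)\<in>{(i, j). i < n \<and> j < n \<and> i \<noteq> j}. (1 - 2 * real (codegree E (Suc i) (Suc j)))\<^sup>2)"
proof -
  have "(\<Sum>\<rho>\<in>#seidel_spectrum n E. \<rho>\<^sup>2) =
      (\<Sum>(i, j)\<in>{..<n} \<times> {..<n}. (seidel_matrix n E $$ (i, j))\<^sup>2)"
    unfolding seidel_spectrum_def
    by (simp add: sum_proots_square_symmetric[OF seidel_matrix_carrier transpose_seidel_matrix]
        sum.cartesian_product)
  also have "\<dots> =
      (\<Sum>(i, j)\<in>{(i, j). i < n \<and> j < n \<and> i \<noteq> j}. (1 - 2 * real (codegree E (Suc i) (Suc j)))\<^sup>2)"
    by (rule sum.mono_neutral_cong_right) (auto simp: seidel_matrix_def)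
  finally show ?thesis .
qed

lemma finite_off_diagonal: "finite {(i, j). i < n \<and> j < n \<and> i \<noteq> (j::nat)}"
  by (rule finite_subset[of _ "{..<n} \<times> {..<n}"]) auto

lemma card_off_diagonal: "real (card {(i, j). i < n \<and> j < n \<and> i \<noteq> (j::nat)}) = real n * (real n - 1)"
proof -
  have eq: "{(i, j). i < n \<and> j < n \<and> i \<noteq> j} = (SIGMA i:{..<n}. {..<n} - {i})"
    by auto
  have "card {(i, j). i < n \<and> j < n \<and> i \<noteq> j} = n * (n - 1)"
    unfolding eq by (subst card_SigmaI) auto
  \<comment> \<open>Truncated and real subtraction differ only at \<open>n = 0\<close>, where the
    factor \<open>n\<close> makes both products zero.\<close>
  then show ?thesis by (cases n) (auto simp: algebra_simps)
qed

lemma one_le_square_odd: "1 \<le> (1 - 2 * real c)\<^sup>2"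
  by (cases c) (auto simp: power2_eq_square algebra_simps)

lemma square_odd_eq_1_iff: "(1 - 2 * real c)\<^sup>2 = 1 \<longleftrightarrow> c \<le> 1"
  by (auto simp: power2_eq_1_iff)

lemma sum_seidel_spectrum_square_ge:
  "real n * (real n - 1) \<le> (\<Sum>\<rho>\<in>#seidel_spectrum n E. \<rho>\<^sup>2)"
  unfolding sum_seidel_spectrum_square card_off_diagonal[symmetric] real_of_card
  by (rule sum_mono) (auto simp: one_le_square_odd)

lemma sum_seidel_spectrum_square_eq_iff:
  "(\<Sum>\<rho>\<in>#seidel_spectrum n E. \<rho>\<^sup>2) = real n * (real n - 1) \<longleftrightarrow>
     (\<forall>i\<in>{1..n}. \<forall>j\<in>{1..n}. i \<noteq> j \<longrightarrow> codegree E i j \<le> 1)"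
proof -
  let ?I = "{(i, j). i < n \<and> j < n \<and> i \<noteq> j}"
  let ?s = "\<lambda>(i, j). (1 - 2 * real (codegree E (Suc i) (Suc j)))\<^sup>2"
  \<comment> \<open>Writing the number of pairs as a sum of ones leaves a sum of nonnegative
    excesses, which is zero only if each of them is.\<close>
  have "(\<Sum>\<rho>\<in>#seidel_spectrum n E. \<rho>\<^sup>2) = real n * (real n - 1) \<longleftrightarrow> (\<Sum>p\<in>?I. ?s p - 1) = 0"
    unfolding sum_seidel_spectrum_square card_off_diagonal[symmetric] real_of_card
    by (simp add: sum_subtractf)
  also have "\<dots> \<longleftrightarrow> (\<forall>p\<in>?I. ?s p - 1 = 0)"
    by (rule sum_nonneg_eq_0_iff) (auto simp: finite_off_diagonal one_le_square_odd)
  also have "\<dots> \<longleftrightarrow> (\<forall>i<n. \<forall>j<n. i \<noteq> j \<longrightarrow> codegree E (Suc i) (Suc j) \<le> 1)"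
    by (auto simp: square_odd_eq_1_iff)
  also have "\<dots> \<longleftrightarrow> (\<forall>i\<in>{1..n}. \<forall>j\<in>{1..n}. i \<noteq> j \<longrightarrow> codegree E i j \<le> 1)"
  proof -
    have "{1..n} = Suc ` {..<n}" by (rule image_Suc_lessThan[symmetric])
    then show ?thesis by auto
  qed
  finally show ?thesis .
qed

text \<open>Both sides forbid two distinct edges with two distinct common vertices; the left
  quantifies over the edges first, the right over the vertices.\<close>

lemma linear_iff_codegree_le_1:
  assumes "simple_hypergraph n E"
  shows "linear_hypergraph n E \<longleftrightarrow> (\<forall>i\<in>{1..n}. \<forall>j\<in>{1..n}. i \<noteq> j \<longrightarrow> codegree E i j \<le> 1)"
proof -
  have E: "E \<subseteq> Pow {1..n}" using assms by (simp add: simple_hypergraph_def)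
  \<comment> \<open>Finiteness matters because \<open>card\<close> of an infinite set is 0, which
    would make a bound on it meaningless.\<close>
  then have fin: "finite E" "finite e" if "e \<in> E" for e
    using that by (auto intro: finite_subset)
  have finE: "finite E" using E by (rule finite_subset) simp
  have "linear_hypergraph n E \<longleftrightarrow>
      (\<forall>e\<in>E. \<forall>e'\<in>E. e \<noteq> e' \<longrightarrow> (\<forall>i\<in>e \<inter> e'. \<forall>j\<in>e \<inter> e'. i = j))"
    using assms fin by (auto simp: linear_hypergraph_def card_le_Suc0_iff_eq)
  also have "\<dots> \<longleftrightarrow> (\<forall>i\<in>{1..n}. \<forall>j\<in>{1..n}. i \<noteq> j \<longrightarrow>
      (\<forall>e\<in>{e \<in> E. i \<in> e \<and> j \<in> e}. \<forall>e'\<in>{e \<in> E. i \<in> e \<and> j \<in> e}. e = e'))"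
    using E by blast
  also have "\<dots> \<longleftrightarrow> (\<forall>i\<in>{1..n}. \<forall>j\<in>{1..n}. i \<noteq> j \<longrightarrow> codegree E i j \<le> 1)"
    using finE by (simp add: codegree_def card_le_Suc0_iff_eq)
  finally show ?thesis .
qed

lemma seidel_energy_nonneg: "0 \<le> seidel_energy n E"
  unfolding seidel_energy_def by (rule sum_mset_abs_nonneg)

lemma seidel_energy_ge: "sqrt (real n * (real n - 1)) \<le> seidel_energy n E"
  using sum_seidel_spectrum_square_ge[of n E]
    sum_mset_square_le_square_sum_abs[of "seidel_spectrum n E"]
  by (intro real_le_lsqrt seidel_energy_nonneg) (simp add: seidel_energy_def)

lemma seidel_energy_eq_imp_linear:
  assumes "simple_hypergraph n E" "n > 0" "seidel_energy n E = sqrt (real n * (real n - 1))"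
  shows "linear_hypergraph n E"
proof -
  \<comment> \<open>By \<open>n > 0\<close> the radicand is nonnegative. The sum of squares is then
    squeezed between \<open>real n * (real n - 1)\<close> and the squared energy.\<close>
  have "(seidel_energy n E)\<^sup>2 = real n * (real n - 1)"
    using assms(2,3) by simp
  then have "(\<Sum>\<rho>\<in>#seidel_spectrum n E. \<rho>\<^sup>2) = real n * (real n - 1)"
    using sum_seidel_spectrum_square_ge[of n E]
      sum_mset_square_le_square_sum_abs[of "seidel_spectrum n E"]
    by (simp add: seidel_energy_def)
  then show ?thesis
    by (simp add: sum_seidel_spectrum_square_eq_iff linear_iff_codegree_le_1[OF assms(1)])
qed

lemma linear_imp_seidel_energy_le:
  assumes "linear_hypergraph n E"
  shows "seidel_energy n E \<le> real n * sqrt (real n - 1)"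
proof -
  have "simple_hypergraph n E"
    using assms by (simp add: linear_hypergraph_def)
  then have "(\<Sum>\<rho>\<in>#seidel_spectrum n E. \<rho>\<^sup>2) = real n * (real n - 1)"
    using assms by (simp add: sum_seidel_spectrum_square_eq_iff linear_iff_codegree_le_1)
  \<comment> \<open>One factor \<open>n\<close> is the number of eigenvalues in Cauchy-Schwarz, the
    other comes from the sum of their squares.\<close>
  then have "(seidel_energy n E)\<^sup>2 \<le> (real n)\<^sup>2 * (real n - 1)"
    using square_sum_abs_le_size_mult_sum_mset_square[of "seidel_spectrum n E"]
    by (simp add: seidel_energy_def size_seidel_spectrum power2_eq_square mult.assoc)
  then have "seidel_energy n E \<le> sqrt ((real n)\<^sup>2 * (real n - 1))"
    by (rule real_le_rsqrt)
  then show ?thesis by (simp add: real_sqrt_mult)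
qed

theorem theorem3p10:
  fixes k n :: nat
  assumes "k > 0" and "n > 0"
  shows "(\<forall>E. simple_hypergraph n E \<and> uniform_edges k E \<longrightarrow>
            seidel_energy n E \<ge> sqrt (real n * (real n - 1))) \<and>
         (\<forall>E. simple_hypergraph n E \<and> uniform_edges k E \<and>
            seidel_energy n E = sqrt (real n * (real n - 1)) \<longrightarrow>
            linear_hypergraph n E) \<and>
         (\<forall>E. linear_hypergraph n E \<and> uniform_edges k E \<longrightarrow>
            sqrt (real n * (real n - 1)) \<le> seidel_energy n E \<and>
            seidel_energy n E \<le> real n * sqrt (real n - 1))"
  using assms seidel_energy_ge seidel_energy_eq_imp_linear linear_imp_seidel_energy_le by blast

end
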